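(* Suppose that, for each $t=1,\dots,T$, the cost function is $C_t(x)=c_t x$ for $x\in X_t$, where $c_t\in\mathbb{R}$ (i.e. unit buying and selling prices coincide). For each $t$ define $$\hat s_t=\operatorname*{arg\,min}_{s\in[0,E_t]}\bigl[c_t s+A_t(s)+V_t(s)\bigr].$$ Then, for each $t$ and for each level $s_{t-1}$, we have $\hat x_t(s_{t-1})=\hat s_t-s_{t-1}$, provided only that $\hat s_t-s_{t-1}$ belongs to the set $X_t$.
   Context: Time periods are $t=1,\dots,T$. A store has capacity $E_t>0$ in period $t$, and input and output rate limits $P_{It},P_{Ot}\ge 0$; put $X_t=\{x\in\mathbb{R}:-P_{Ot}\le x\le P_{It}\}$. The cost of a planned change $x\in X_t$ of the store level in period $t$ is $C_t(x)$, a real-valued function on $X_t$. In the price-taker case $C_t(x)=c^{(b)}_t x$ for $x\ge 0$ and $C_t(x)=c^{(s)}_t x$ for $x<0$, with $c^{(s)}_t\le c^{(b)}_t$; here $c^{(b)}_t=c^{(s)}_t=c_t$. For each $t$, $A_t$ is a given real-valued function of the planned level at the end of period $t$ (the expected additional cost of dealing with random shocks). The functions $V_t$ (minimal expected future cost from the end of period $t$) are defined by $V_T(s)=0$ for all possible levels $s$, and, for $t=T,\dots,1$, $$V_{t-1}(s_{t-1})=\min_{x_t\in X_t,\ s_{t-1}+x_t\in[0,E_t]}\bigl[C_t(x_t)+A_t(s_{t-1}+x_t)+V_t(s_{t-1}+x_t)\bigr].$$ Levels are nonnegative reals. $V_{t-1}(s_{t-1})=+\infty$ if there is no feasible $x_t$,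 and statements about $s_{t-1}$ refer to those levels with $V_{t-1}(s_{t-1})<\infty$. The displayed minima are assumed to be attained. $\hat x_t(s_{t-1})$ denotes the value of $x_t$ achieving the minimum in the recursion. In case of nonuniqueness, $\arg\min$ denotes any minimiser, and the equality $\hat x_t(s_{t-1})=x$ means that $x$ achieves the minimum in the recursion. *)

theory Defs
  imports Complex_Main "HOL-Library.Extended_Real"
begin

context
  fixes T :: nat
    and E P_I P_O :: "nat \<Rightarrow> real"
    and C A :: "nat \<Rightarrow> real \<Rightarrow> real"
begin

definition rate_set :: "nat \<Rightarrow> real set" where
  "rate_set t = {- P_O t..P_I t}"

definition feasible :: "nat \<Rightarrow> real \<Rightarrow> real set" where
  "feasible t s = {x \<in> rate_set t. s + x \<in> {0..E t}}"

text \<open>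
  \<open>future_cost t\<close> is the function \<open>V\<^sub>t\<close>: the minimal expected future cost, as a function of
  the level at the end of period \<open>t\<close>, where the periods are \<open>1, \<dots>, T\<close>. It is extended-real
  valued: the infimum over an empty feasible set is \<open>\<infinity>\<close>. Attainment of the infima is a separate
  condition, \<open>minima_attained\<close> below. Only the arguments \<open>t \<le> T\<close> are meaningful; the functions
  \<open>C t\<close> and \<open>A t\<close> are evaluated only on \<open>rate_set t\<close> and on \<open>{0..E t}\<close>, respectively.
\<close>

function future_cost :: "nat \<Rightarrow> real \<Rightarrow> ereal" where
  "future_cost t s =
    (if T \<le> t then 0
     else INF x \<in> feasible (Suc t) s.
       ereal (C (Suc t) x) + ereal (A (Suc t) (s + x)) + future_cost (Suc t) (s + x))"
  by pat_completeness auto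
termination
  by (relation "measure (\<lambda>(t, s). T - t)") auto

declare future_cost.simps [simp del]

definition stage_cost :: "nat \<Rightarrow> real \<Rightarrow> real \<Rightarrow> ereal" where
  "stage_cost t s x = ereal (C t x) + ereal (A t (s + x)) + future_cost t (s + x)"

text \<open>
  The minimiser in the recursion need not be unique; \<open>optimal_change t s x\<close> says that \<open>x\<close> achieves
  the minimum defining \<open>V\<^bsub>t-1\<^esub>(s)\<close>.
\<close>

definition optimal_change :: "nat \<Rightarrow> real \<Rightarrow> real \<Rightarrow> bool" where
  "optimal_change t s x \<longleftrightarrow> is_arg_min (stage_cost t s) (\<lambda>x. x \<in> feasible t s) x"

definition minima_attained :: bool where
  "minima_attained \<longleftrightarrow>
    (\<forall>t\<in>{1..T}. \<forall>s\<ge>0. feasible t s \<noteq> {} \<longrightarrow> (\<exists>x. optimal_change t s x))"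

end

lemma future_cost_final: "future_cost T E P_I P_O C A T s = 0"
  by (simp add: future_cost.simps)

lemma future_cost_recursion:
  assumes "t \<in> {1..T}"
  shows "future_cost T E P_I P_O C A (t - 1) s =
    (INF x \<in> feasible E P_I P_O t s. stage_cost T E P_I P_O C A t s x)"
  using assms by (subst future_cost.simps) (auto simp: stage_cost_def)

end

theory Submission
  imports Defs
begin

text \<open>
  With one unit price \<open>c\<close> for buying and selling, the cost of moving from level \<open>s\<close> to level \<open>s'\<close>
  is \<open>c * s' - c * s\<close>, so it separates into a part depending only on the target and a part
  depending only on the start. Hence, for a fixed start, choosing the change \<open>x\<close> is the same as
  choosing the target \<open>s + x\<close> so as to minimise \<open>c * s' + A s' + V s'\<close>, an objective in which the
  start no longer occurs (\<open>target_objective_eq_shifted_stage_cost\<close>). The start only restricts which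
  targets can be reached. A minimiser over all of \<open>[0, E]\<close> is a fortiori a minimiser over the
  reachable targets, as soon as it is itself reachable. The argument concerns a single period and
  makes no induction over time.
\<close>

text \<open>
  The offset between the two objectives is the finite constant \<open>c * s\<close>, so they rank changes
  identically even where \<open>V\<close> is infinite.
\<close>

lemma target_objective_eq_shifted_stage_cost:
  assumes "C t x = c * x"
  shows "ereal (c * (s + x)) + ereal (A t (s + x)) + future_cost T E P_I P_O C A t (s + x) =
    ereal (c * s) + stage_cost T E P_I P_O C A t s x"
  using assms by (simp add: stage_cost_def distrib_left add.assoc flip: plus_ereal.simps(1))

lemma optimal_change_to_global_target:
  assumes linear: "\<And>x. x \<in> rate_set P_I P_O t \<Longrightarrow> C t x = c * x"
    and target: "is_arg_min
      (\<lambda>s. ereal (c * s) + ereal (A t s) + future_cost T E P_I P_O C A t s)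
      (\<lambda>s. s \<in> {0..E t}) s'"
    and reachable: "s' - s \<in> rate_set P_I P_O t"
  shows "optimal_change T E P_I P_O C A t s (s' - s)"
proof -
  have s': "s' \<in> {0..E t}"
    using target by (simp add: is_arg_min_def)
  have "stage_cost T E P_I P_O C A t s (s' - s) \<le> stage_cost T E P_I P_O C A t s y"
    if y: "y \<in> feasible E P_I P_O t s" for y
  proof -
    have y_rate: "y \<in> rate_set P_I P_O t" and y_level: "s + y \<in> {0..E t}"
      using y by (auto simp: feasible_def)
    have "ereal (c * s') + ereal (A t s') + future_cost T E P_I P_O C A t s' \<le>
        ereal (c * (s + y)) + ereal (A t (s + y)) + future_cost T E P_I P_O C A t (s + y)"
      using target y_level unfolding is_arg_min_def by (meson not_less)
    then have "ereal (c * s) + stage_cost T E P_I P_O C A t s (s' - s) \<le>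
        ereal (c * s) + stage_cost T E P_I P_O C A t s y"
      using target_objective_eq_shifted_stage_cost[of C t "s' - s" c s A T E P_I P_O]
        target_objective_eq_shifted_stage_cost[of C t y c s A T E P_I P_O]
        linear[OF reachable] linear[OF y_rate]
      by simp
    then show ?thesis
      by (simp add: ereal_add_le_add_iff)
  qed
  moreover have "s' - s \<in> feasible E P_I P_O t s"
    using reachable s' by (simp add: feasible_def)
  ultimately show ?thesis
    by (auto simp: optimal_change_def is_arg_min_def not_less)
qed

theorem proposition1:
  fixes T :: nat
    and E P_I P_O c s_hat :: "nat \<Rightarrow> real"
    and C A :: "nat \<Rightarrow> real \<Rightarrow> real"
  assumes "\<forall>t\<in>{1..T}. E t > 0"
    and "\<forall>t\<in>{1..T}. P_I t \<ge> 0 \<and> P_O t \<ge> 0"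
    and "minima_attained T E P_I P_O C A"
    and "\<forall>t\<in>{1..T}. \<forall>x\<in>rate_set P_I P_O t. C t x = c t * x"
    and "\<forall>t\<in>{1..T}.
      is_arg_min (\<lambda>s. ereal (c t * s) + ereal (A t s) + future_cost T E P_I P_O C A t s)
        (\<lambda>s. s \<in> {0..E t}) (s_hat t)"
  shows "\<forall>t\<in>{1..T}. \<forall>s\<ge>0.
    future_cost T E P_I P_O C A (t - 1) s < \<infinity> \<longrightarrow>
    s_hat t - s \<in> rate_set P_I P_O t \<longrightarrow>
    optimal_change T E P_I P_O C A t s (s_hat t - s)"
  using assms(4,5) by (auto intro!: optimal_change_to_global_target)

end
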